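(* Let $q$ be a prime power, let $n,m\ge 2$ be integers and let $i\in\{2,\dots,n\}$. The modular elements of the lattice $\mathscr{L}_i(n,m;q)$ are exactly the $\mathbb{F}_{q^m}$-linear subspaces $X\le\mathbb{F}_{q^m}^n$ with $X\subseteq T_i(n,m;q)$, together with $\mathbb{F}_{q^m}^n$ itself.
   Context: $\mathbb{F}_{q^m}$ denotes the extension of degree $m$ of $\mathbb{F}_q$. The rank $\mathrm{rk}(v)$ of $v\in\mathbb{F}_{q^m}^n$ is the $\mathbb{F}_q$-dimension of the $\mathbb{F}_q$-span of its entries, and $T_i(n,m;q)=\{v\in\mathbb{F}_{q^m}^n:\mathrm{rk}(v)\le i\}$. The lattice $\mathscr{L}_i(n,m;q)$ is the set of $\mathbb{F}_{q^m}$-subspaces of $\mathbb{F}_{q^m}^n$ spanned by elements of $T_i(n,m;q)$ (including $\{0\}$), ordered by inclusion; its rank function is $\dim_{\mathbb{F}_{q^m}}$, the join of $X,Y$ is $X+Y$ and the meet is $X\wedge_i Y=\langle x\in X\cap Y:\mathrm{rk}(x)\le i\rangle_{\mathbb{F}_{q^m}}$. An element $X$ is modular if $\dim(X\wedge_i Y)+\dim(X+Y)=\dim X+\dim Y$ for all $Y\in\mathscr{L}_i(n,m;q)$. *)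

theory Defs
  imports "HOL-Analysis.Analysis" "HOL-Number_Theory.Prime_Powers"
begin

text \<open>
  A field extension is given by two field types and a (necessarily injective) unital ring
  homomorphism, so that the linear algebra over the small field is that of the library locale
  \<^locale>\<open>vector_space\<close> for the scalar multiplication below.
\<close>

definition ext_scale :: "('k::field \<Rightarrow> 'a::field) \<Rightarrow> 'k \<Rightarrow> 'a \<Rightarrow> 'a" where
  "ext_scale emb c x = emb c * x"

locale field_extension =
  fixes emb :: "'k::field \<Rightarrow> 'a::field"
  assumes emb_add: "emb (x + y) = emb x + emb y"
    and emb_mult: "emb (x * y) = emb x * emb y"
    and emb_one: "emb 1 = 1"
begin

sublocale ext: vector_space "ext_scale emb"
  by unfold_locales (simp_all add: ext_scale_def emb_add emb_mult emb_one algebra_simps)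

end

definition ext_degree :: "('k::field \<Rightarrow> 'a::field) \<Rightarrow> nat" where
  "ext_degree emb = vector_space.dim (ext_scale emb) UNIV"

definition rk :: "('k::field \<Rightarrow> 'a::field) \<Rightarrow> 'a ^ 'n \<Rightarrow> nat" where
  "rk emb v = vector_space.dim (ext_scale emb) (module.span (ext_scale emb) (range (vec_nth v)))"

definition T :: "('k::field \<Rightarrow> 'a::field) \<Rightarrow> nat \<Rightarrow> ('a ^ 'n) set" where
  "T emb i = {v. rk emb v \<le> i}"

text \<open>The choice \<open>S = {}\<close> below yields the zero space.\<close>

definition rank_lattice :: "('k::field \<Rightarrow> 'a::field) \<Rightarrow> nat \<Rightarrow> ('a ^ 'n) set set" where
  "rank_lattice emb i = {vec.span S | S. S \<subseteq> T emb i}"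

definition lattice_join :: "('a::field ^ 'n) set \<Rightarrow> ('a ^ 'n) set \<Rightarrow> ('a ^ 'n) set" where
  "lattice_join X Y = {x + y | x y. x \<in> X \<and> y \<in> Y}"

definition lattice_meet ::
    "('k::field \<Rightarrow> 'a::field) \<Rightarrow> nat \<Rightarrow> ('a ^ 'n) set \<Rightarrow> ('a ^ 'n) set \<Rightarrow> ('a ^ 'n) set" where
  "lattice_meet emb i X Y = vec.span {x \<in> X \<inter> Y. rk emb x \<le> i}"

definition modular_element :: "('k::field \<Rightarrow> 'a::field) \<Rightarrow> nat \<Rightarrow> ('a ^ 'n) set \<Rightarrow> bool" where
  "modular_element emb i X \<longleftrightarrow>
     X \<in> rank_lattice emb i \<and>
     (\<forall>Y \<in> rank_lattice emb i.
        vec.dim (lattice_meet emb i X Y) + vec.dim (lattice_join X Y) = vec.dim X + vec.dim Y)"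

text \<open>The join and meet are indeed the supremum and infimum with respect to inclusion.\<close>

lemma lattice_join_eq_span:
  assumes "X \<in> rank_lattice emb i" "Y \<in> rank_lattice emb i"
  shows "lattice_join X Y = vec.span (X \<union> Y)"
proof -
  have "vec.span X = X" "vec.span Y = Y"
    using assms by (auto simp: rank_lattice_def vec.span_span)
  then show ?thesis
    unfolding lattice_join_def vec.span_Un by (simp only:)
qed

lemma lattice_join_supremum:
  assumes "X \<in> rank_lattice emb i" "Y \<in> rank_lattice emb i"
  shows "lattice_join X Y \<in> rank_lattice emb i"
    and "X \<subseteq> lattice_join X Y" "Y \<subseteq> lattice_join X Y"
    and "\<And>Z. Z \<in> rank_lattice emb i \<Longrightarrow> X \<subseteq> Z \<Longrightarrow> Y \<subseteq> Z \<Longrightarrow> lattice_join X Y \<subseteq> Z"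
proof -
  obtain A B where A: "A \<subseteq> T emb i" "X = vec.span A" and B: "B \<subseteq> T emb i" "Y = vec.span B"
    using assms by (auto simp: rank_lattice_def)
  have "lattice_join X Y = vec.span (A \<union> B)"
    by (simp add: lattice_join_def vec.span_Un A(2) B(2))
  then show "lattice_join X Y \<in> rank_lattice emb i"
    using A(1) B(1) by (auto simp: rank_lattice_def)
  show "X \<subseteq> lattice_join X Y" "Y \<subseteq> lattice_join X Y"
    unfolding lattice_join_eq_span[OF assms] using vec.span_superset by blast+
  fix Z assume "Z \<in> rank_lattice emb i" "X \<subseteq> Z" "Y \<subseteq> Z"
  then show "lattice_join X Y \<subseteq> Z"
    unfolding lattice_join_eq_span[OF assms]
    by (intro vec.span_minimal) (auto simp: rank_lattice_def)
qed

lemma lattice_meet_infimum: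
  assumes "X \<in> rank_lattice emb i" "Y \<in> rank_lattice emb i"
  shows "lattice_meet emb i X Y \<in> rank_lattice emb i"
    and "lattice_meet emb i X Y \<subseteq> X" "lattice_meet emb i X Y \<subseteq> Y"
    and "\<And>Z. Z \<in> rank_lattice emb i \<Longrightarrow> Z \<subseteq> X \<Longrightarrow> Z \<subseteq> Y \<Longrightarrow> Z \<subseteq> lattice_meet emb i X Y"
proof -
  have sub: "vec.subspace X" "vec.subspace Y"
    using assms by (auto simp: rank_lattice_def)
  show "lattice_meet emb i X Y \<in> rank_lattice emb i"
    unfolding rank_lattice_def lattice_meet_def T_def by blast
  show "lattice_meet emb i X Y \<subseteq> X" "lattice_meet emb i X Y \<subseteq> Y"
    unfolding lattice_meet_def by (rule vec.span_minimal; use sub in blast)+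
  fix Z assume Z: "Z \<in> rank_lattice emb i" "Z \<subseteq> X" "Z \<subseteq> Y"
  then obtain S where S: "S \<subseteq> T emb i" "Z = vec.span S"
    by (auto simp: rank_lattice_def)
  have "S \<subseteq> {x \<in> X \<inter> Y. rk emb x \<le> i}"
    using S Z vec.span_superset[of S] by (auto simp: T_def)
  then show "Z \<subseteq> lattice_meet emb i X Y"
    unfolding lattice_meet_def S(2) by (rule vec.span_mono)
qed

end

theory Submission
  imports Defs
begin

text \<open>
  An element \<open>X\<close> is not modular as soon as \<open>X \<inter> Y\<close> is a line spanned by a vector of rank
  greater than \<open>i\<close>, for some \<open>Y = \<langle>a, b\<rangle>\<close> with \<open>a, b\<close> of rank at most \<open>i\<close>. If \<open>X\<close> contains a
  vector of rank greater than \<open>i\<close>, it contains \<open>x, y\<close> of rank at most \<open>i\<close> whose sum has larger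
  rank, and one perturbs them to \<open>a = x + z\<close>, \<open>b = y - z\<close> with \<open>z \<notin> X\<close>. Write
  \<open>y = \<Sum>k. \<beta>\<^sub>k c\<^sub>k\<close> with \<open>c\<^sub>k\<close> over the small field and as many terms as the rank of \<open>y\<close>, and let
  \<open>\<alpha>\<close> be a nonzero entry of \<open>x\<close>. If some \<open>c\<^sub>k \<notin> X\<close>, then \<open>z = \<alpha> c\<^sub>k\<close> does not raise either
  rank. If all \<open>c\<^sub>k \<in> X\<close>, adding the terms to \<open>x\<close> one by one reduces to the case that \<open>y\<close> has
  rank one; then \<open>z = \<alpha> e\<close> with a unit vector \<open>e \<notin> X\<close> works, since \<open>y - z\<close> has rank at most
  \<open>2 \<le> i\<close>.
\<close>

lemma subspace_scale_notin:
  fixes z :: "'a::field ^ 'n::finite"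
  assumes "vec.subspace X" "z \<notin> X" "a \<noteq> 0"
  shows "a *s z \<notin> X"
  using vec.subspace_scale[OF assms(1), of "a *s z" "inverse a"] assms by auto

context field_extension
begin

lemma emb_zero: "emb 0 = 0"
  using emb_add[of 0 0] by (simp only: add_0 add_cancel_right_right)

section \<open>Rank of vectors over the small field\<close>

lemma rk_eq_dim: "rk emb v = ext.dim (range (vec_nth v))"
  by (simp add: rk_def)

lemma rk_le_card:
  assumes "finite B" "\<And>j. v $ j \<in> ext.span B"
  shows "rk emb v \<le> card B"
  unfolding rk_eq_dim using assms by (intro ext.dim_le_card) auto

lemma rk_basis:
  fixes v :: "'a ^ 'n::finite"
  obtains B where "finite B" "card B = rk emb v" "\<And>j. v $ j \<in> ext.span B"
proof -
  obtain B where B: "B \<subseteq> range (vec_nth v)" "range (vec_nth v) \<subseteq> ext.span B"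
    "card B = ext.dim (range (vec_nth v))"
    using ext.basis_exists by metis
  moreover have "finite B"
    using B(1) by (rule finite_subset) simp
  ultimately show thesis
    using that[of B] by (auto simp: rk_eq_dim)
qed

lemma rk_zero: "rk emb (0 :: 'a ^ 'n::finite) = 0"
  using rk_le_card[of "{}" "0 :: 'a ^ 'n"] by simp

text \<open>Multiplication by \<open>c\<close> is linear over the small field, so it carries a set
  spanning the entries of \<open>v\<close> to one spanning those of \<open>c *s v\<close>.\<close>

lemma rk_scale_le: "rk emb (c *s (v :: 'a ^ 'n::finite)) \<le> rk emb v"
proof -
  obtain B where B: "finite B" "card B = rk emb v" "\<And>j. v $ j \<in> ext.span B"
    using rk_basis by metis
  have "c * y \<in> ext.span ((*) c ` B)" if "y \<in> ext.span B" for y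
    using that
  proof (induction rule: ext.span_induct_alt)
    case (step k b y)
    have "c * (ext_scale emb k b + y) = ext_scale emb k (c * b) + c * y"
      by (simp add: ext_scale_def algebra_simps)
    then show ?case
      using step by (auto intro!: ext.span_add ext.span_scale intro: ext.span_base)
  qed (simp add: ext.span_zero)
  then have "rk emb (c *s v) \<le> card ((*) c ` B)"
    using B by (intro rk_le_card) auto
  also have "\<dots> \<le> rk emb v"
    using B card_image_le by metis
  finally show ?thesis .
qed

lemma rk_scale: "c \<noteq> 0 \<Longrightarrow> rk emb (c *s (v :: 'a ^ 'n::finite)) = rk emb v"
  using rk_scale_le[of c v] rk_scale_le[of "inverse c" "c *s v"] by simp

lemma scale_emb_vec_in_span:
  assumes "a \<in> ext.span B"
  shows "(a *s (\<chi> j. emb (f j)) :: 'a ^ 'n::finite) $ l \<in> ext.span B"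
  using ext.span_scale[OF assms, of "f l"] by (simp add: ext_scale_def mult.commute)

text \<open>The added vector has only small-field multiples of the entry \<open>x $ l\<close> as
  entries, so the sum stays within the span of the entries of \<open>x\<close>.\<close>

lemma rk_add_scale_emb_vec_le:
  fixes x :: "'a ^ 'n::finite"
  shows "rk emb (x + (x $ l) *s (\<chi> j. emb (f j))) \<le> rk emb x"
proof -
  obtain B where B: "finite B" "card B = rk emb x" "\<And>j. x $ j \<in> ext.span B"
    using rk_basis by metis
  have "rk emb (x + (x $ l) *s (\<chi> j. emb (f j))) \<le> card B"
    using B(1,3) scale_emb_vec_in_span[OF B(3), where 'n = 'n]
    by (intro rk_le_card) (auto intro!: ext.span_add simp del: vector_smult_component)
  then show ?thesis
    using B by simp
qed

text \<open>All entries lie in the small-field span of the coefficients \<open>g b\<close>; these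
  may coincide, hence only a bound.\<close>

lemma rk_sum_scale_emb_vec_le:
  assumes "finite B"
  shows "rk emb (\<Sum>b\<in>B. g b *s (\<chi> j. emb (f b j)) :: 'a ^ 'n::finite) \<le> card B"
proof -
  have "rk emb (\<Sum>b\<in>B. g b *s (\<chi> j. emb (f b j)) :: 'a ^ 'n) \<le> card (g ` B)"
  proof (rule rk_le_card)
    fix l
    have "(g b *s (\<chi> j. emb (f b j)) :: 'a ^ 'n) $ l \<in> ext.span (g ` B)" if "b \<in> B" for b
      using that by (intro scale_emb_vec_in_span ext.span_base) simp
    then show "(\<Sum>b\<in>B. g b *s (\<chi> j. emb (f b j)) :: 'a ^ 'n) $ l \<in> ext.span (g ` B)"
      unfolding sum_component by (rule ext.span_sum)
  qed (use assms in simp)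
  also have "\<dots> \<le> card B"
    using assms by (rule card_image_le)
  finally show ?thesis .
qed

text \<open>Expand every entry in a common basis and collect terms by basis element. The elements of
  \<open>B\<close> serve as both indices and coefficients.\<close>

lemma rk_decomposition:
  fixes v :: "'a ^ 'n::finite"
  obtains B f where "finite B" "card B = rk emb v" "v = (\<Sum>b\<in>B. b *s (\<chi> j. emb (f b j)))"
proof -
  obtain B where B: "finite B" "card B = rk emb v" "\<And>j. v $ j \<in> ext.span B"
    using rk_basis by metis
  have "\<exists>u. v $ j = (\<Sum>b\<in>B. ext_scale emb (u b) b)" for j
    using B(3)[of j] unfolding ext.span_finite[OF B(1)] by auto
  then obtain u where u: "\<And>j. v $ j = (\<Sum>b\<in>B. ext_scale emb (u j b) b)"
    by metis
  show thesis
    by (rule that[OF B(1,2), of "\<lambda>b j. u j b"])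
      (simp add: vec_eq_iff u ext_scale_def mult.commute)
qed

lemma axis_eq_emb_vec: "(axis l 1 :: 'a ^ 'n::finite) = (\<chi> j. emb (if j = l then 1 else 0))"
  by (auto simp: axis_def vec_eq_iff emb_zero emb_one)

lemma rk_axis_le: "rk emb (axis l 1 :: 'a ^ 'n::finite) \<le> 1"
  using rk_sum_scale_emb_vec_le[of "{()}" "\<lambda>_. 1" "\<lambda>_ j. if j = l then 1 else 0"]
  by (simp add: axis_eq_emb_vec)

section \<open>Lattice elements and the dimension formula\<close>

lemma subspace_in_rank_lattice:
  "vec.subspace X \<Longrightarrow> X \<subseteq> T emb i \<Longrightarrow> X \<in> rank_lattice emb i"
  unfolding rank_lattice_def using vec.span_eq_iff by blast

lemma span_axes: "vec.span (range (\<lambda>l. axis l 1)) = (UNIV :: ('a ^ 'n::finite) set)"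
proof -
  have "v \<in> vec.span (range (\<lambda>l. axis l 1))" for v :: "'a ^ 'n"
  proof -
    have "(\<Sum>l\<in>UNIV. v $ l *s axis l 1) \<in> vec.span (range (\<lambda>l. axis l 1))"
      by (intro vec.span_sum vec.span_scale vec.span_base) auto
    then show ?thesis
      by (simp add: basis_expansion)
  qed
  then show ?thesis by blast
qed

lemma UNIV_in_rank_lattice:
  assumes "1 \<le> i"
  shows "(UNIV :: ('a ^ 'n::finite) set) \<in> rank_lattice emb i"
proof -
  have "range (\<lambda>l. axis l 1) \<subseteq> (T emb i :: ('a ^ 'n) set)"
    using rk_axis_le assms by (auto simp: T_def intro: order_trans)
  then show ?thesis
    unfolding rank_lattice_def using span_axes by blast
qed

lemma rank_lattice_subspace: "X \<in> rank_lattice emb i \<Longrightarrow> vec.subspace X"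
  by (auto simp: rank_lattice_def)

text \<open>Compared with the definition of modularity, this reduces modularity of \<open>X\<close>
  to the meet having the dimension of the full intersection.\<close>

lemma rank_lattice_dim_join_Int:
  assumes "X \<in> rank_lattice emb i" "Y \<in> rank_lattice emb i"
  shows "vec.dim (X \<inter> Y) + vec.dim (lattice_join X Y) = vec.dim X + vec.dim Y"
  using vec.dim_sums_Int[OF assms[THEN rank_lattice_subspace]]
  by (simp add: lattice_join_def add.commute)

section \<open>The listed subspaces are modular\<close>

lemma modular_element_subset_T:
  assumes "vec.subspace X" "X \<subseteq> T emb i"
  shows "modular_element emb i X"
proof -
  have X: "X \<in> rank_lattice emb i"
    using assms by (rule subspace_in_rank_lattice)
  \<comment> \<open>Every vector of \<open>X\<close> has rank at most \<open>i\<close>, so the meet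
    discards nothing.\<close>
  have "lattice_meet emb i X Y = X \<inter> Y" if "Y \<in> rank_lattice emb i" for Y
  proof -
    have "{x \<in> X \<inter> Y. rk emb x \<le> i} = X \<inter> Y"
      using assms by (auto simp: T_def)
    then show ?thesis
      using assms(1) that vec.subspace_inter rank_lattice_subspace vec.span_eq_iff
      unfolding lattice_meet_def by metis
  qed
  then show ?thesis
    unfolding modular_element_def using X rank_lattice_dim_join_Int[OF X] by simp
qed

lemma modular_element_UNIV:
  assumes "1 \<le> i"
  shows "modular_element emb i (UNIV :: ('a ^ 'n::finite) set)"
proof -
  have X: "(UNIV :: ('a ^ 'n) set) \<in> rank_lattice emb i"
    using assms by (rule UNIV_in_rank_lattice)
  \<comment> \<open>\<open>Y\<close> is itself a lattice element below both arguments, hence below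
    their meet.\<close>
  have "lattice_meet emb i UNIV Y = UNIV \<inter> Y" if "Y \<in> rank_lattice emb i" for Y :: "('a ^ 'n) set"
    using lattice_meet_infimum(3,4)[OF X that] that by auto
  then show ?thesis
    unfolding modular_element_def using X rank_lattice_dim_join_Int[OF X] by simp
qed

section \<open>Non-modularity of all other lattice elements\<close>

lemma not_modular_element_if_perturbation:
  fixes X :: "('a ^ 'n::finite) set"
  assumes "x \<in> X" "y \<in> X" "z \<notin> X" "i < rk emb (x + y)"
    and a: "rk emb (x + z) \<le> i" and b: "rk emb (y - z) \<le> i"
  shows "\<not> modular_element emb i X"
proof
  assume mod: "modular_element emb i X"
  then have X: "X \<in> rank_lattice emb i" "vec.subspace X"
    using rank_lattice_subspace by (auto simp: modular_element_def)
  define Y where "Y = vec.span {x + z, y - z}"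
  have Y: "Y \<in> rank_lattice emb i"
    unfolding Y_def rank_lattice_def T_def using a b by blast
  have "w = 0" if w: "w \<in> X" "w \<in> Y" "rk emb w \<le> i" for w
  proof -
    obtain p where "w - p *s (x + z) \<in> vec.span {y - z}"
      using w(2) unfolding Y_def vec.span_insert[of "x + z"] by blast
    then obtain r where "w - p *s (x + z) = r *s (y - z)"
      unfolding vec.span_singleton by blast
    then have "w = r *s (y - z) + p *s (x + z)"
      by (simp only: diff_eq_eq)
    then have w_eq: "w = p *s x + r *s y + (p - r) *s z"
      by (simp add: vec.scale_right_distrib vec.scale_right_diff_distrib
          vec.scale_left_diff_distrib)
    \<comment> \<open>The part of \<open>w\<close> along \<open>z\<close> lies in \<open>X\<close>
      while \<open>z\<close> does not, so its coefficient \<open>p - r\<close> vanishes and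
      \<open>w\<close> is a multiple of \<open>x + y\<close>.\<close>
    have "w - (p *s x + r *s y) \<in> X"
      using X(2) assms(1,2) w(1) by (intro vec.subspace_diff vec.subspace_add vec.subspace_scale)
    then have "(p - r) *s z \<in> X"
      by (simp add: w_eq)
    then have "p = r"
      using subspace_scale_notin[OF X(2) \<open>z \<notin> X\<close>, of "p - r"] by auto
    then have "w = r *s (x + y)"
      by (simp add: w_eq vec.scale_right_distrib)
    then show ?thesis
      using rk_scale[of r "x + y"] w(3) assms(4) by (cases "r = 0") auto
  qed
  then have "lattice_meet emb i X Y \<subseteq> {0}"
    unfolding lattice_meet_def by (intro vec.span_minimal) auto
  then have "vec.dim (lattice_meet emb i X Y) = 0"
    by simp
  \<comment> \<open>Modularity and the dimension formula give the meet and the intersection equal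
    dimension.\<close>
  then have "vec.dim (X \<inter> Y) = 0"
    using mod Y rank_lattice_dim_join_Int[OF X(1) Y] unfolding modular_element_def
    by (metis add_right_cancel)
  moreover have "x + y \<in> X \<inter> Y"
  proof -
    have "(x + z) + (y - z) \<in> Y"
      unfolding Y_def by (intro vec.span_add vec.span_base) auto
    then show ?thesis
      using X(2) assms(1,2) vec.subspace_add by auto
  qed
  ultimately have "x + y = 0"
    by auto
  then show False
    using assms(4) rk_zero[where 'n = 'n] by simp
qed

text \<open>The rank of the partial sums starts at most \<open>i\<close> and ends above it, so some
  summand \<open>h b\<close> crosses the bound; \<open>x'\<close> is the partial sum just before
  it.\<close>

lemma rank_jump_in_partial_sums:
  fixes x :: "'a ^ 'n::finite"
  assumes "finite S" "vec.subspace X" "\<And>b. b \<in> S \<Longrightarrow> h b \<in> X"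
    and "x \<in> X" "rk emb x \<le> i" "i < rk emb (x + sum h S)"
  obtains x' b where "x' \<in> X" "b \<in> S" "rk emb x' \<le> i" "i < rk emb (x' + h b)"
proof -
  have "\<exists>x' b. x' \<in> X \<and> b \<in> S \<and> rk emb x' \<le> i \<and> i < rk emb (x' + h b)"
    using assms
  proof (induction S arbitrary: x rule: finite_induct)
    case (insert b S)
    show ?case
    proof (cases "i < rk emb (x + h b)")
      case False
      have "x + h b \<in> X"
        using insert.prems vec.subspace_add by blast
      then show ?thesis
        using insert.IH[of "x + h b"] insert.prems insert.hyps False by (auto simp: add.assoc)
    qed (use insert.prems in blast)
  qed simp
  then show thesis
    using that by blast
qed

text \<open>Otherwise the vectors of rank at most \<open>i\<close> in \<open>X\<close> would be
  closed under addition as well as scaling; as they generate \<open>X\<close>, they would be all of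
  \<open>X\<close>.\<close>

lemma rank_jump_in_lattice_element:
  fixes X :: "('a ^ 'n::finite) set"
  assumes "X \<in> rank_lattice emb i" "\<not> X \<subseteq> T emb i"
  shows "\<exists>x\<in>X. \<exists>y\<in>X. rk emb x \<le> i \<and> rk emb y \<le> i \<and> i < rk emb (x + y)"
proof (rule ccontr)
  assume "\<not> ?thesis"
  then have no_jump: "rk emb (x + y) \<le> i"
    if "x \<in> X" "y \<in> X" "rk emb x \<le> i" "rk emb y \<le> i" for x y
    using that not_le_imp_less by blast
  obtain S where S: "S \<subseteq> T emb i" "X = vec.span S"
    using assms(1) by (auto simp: rank_lattice_def)
  have "v \<in> X \<and> rk emb v \<le> i" if "v \<in> vec.span S" for v
    using that
  proof (induction rule: vec.span_induct_alt)
    case base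
    then show ?case by (simp add: S vec.span_zero rk_zero)
  next
    case (step c s v)
    have "c *s s \<in> X" "rk emb (c *s s) \<le> i"
      using step S rk_scale_le[of c s] by (auto simp: T_def intro: vec.span_scale vec.span_base)
    then show ?case
      using step no_jump S vec.span_add by blast
  qed
  then show False
    using assms(2) S by (auto simp: T_def)
qed

lemma modular_element_cases:
  fixes X :: "('a ^ 'n::finite) set"
  assumes "2 \<le> i" "modular_element emb i X"
  shows "X \<subseteq> T emb i \<or> X = UNIV"
proof (rule ccontr)
  assume contra: "\<not> (X \<subseteq> T emb i \<or> X = UNIV)"
  have X: "X \<in> rank_lattice emb i" "vec.subspace X"
    using assms(2) rank_lattice_subspace unfolding modular_element_def by blast+
  have nonzero_entry: "\<exists>l. x $ l \<noteq> 0"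
    if "rk emb y \<le> i" "i < rk emb (x + y)" for x y :: "'a ^ 'n"
  proof (rule ccontr)
    assume "\<not> ?thesis"
    then have "x = 0" by (simp add: vec_eq_iff)
    then show False using that by simp
  qed
  obtain x y where xy: "x \<in> X" "y \<in> X" "rk emb x \<le> i" "rk emb y \<le> i" "i < rk emb (x + y)"
    using rank_jump_in_lattice_element[OF X(1)] contra by blast
  obtain B f where B: "finite B" "card B = rk emb y"
    and y: "y = (\<Sum>b\<in>B. b *s (\<chi> j. emb (f b j)))"
    using rk_decomposition by metis
  define c :: "'a \<Rightarrow> 'a ^ 'n" where "c b = (\<chi> j. emb (f b j))" for b
  show False
  proof (cases "\<forall>b\<in>B. c b \<in> X")
    case True
    then have "\<And>b. b \<in> B \<Longrightarrow> b *s c b \<in> X"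
      using X(2) vec.subspace_scale by blast
    then obtain x' b where x': "x' \<in> X" "b \<in> B" "b *s c b \<in> X" "rk emb x' \<le> i"
        "i < rk emb (x' + b *s c b)"
      using rank_jump_in_partial_sums[OF B(1) X(2), of "\<lambda>b. b *s c b" x i] xy
      by (auto simp: y c_def)
    have "rk emb (b *s c b) \<le> 1"
      using rk_sum_scale_emb_vec_le[of "{b}" "\<lambda>b. b" f] by (simp add: c_def)
    then obtain l where l: "x' $ l \<noteq> 0"
      using nonzero_entry[of "b *s c b" x'] x' assms(1) by auto
    \<comment> \<open>The unit vectors span the whole space, which \<open>X\<close> is not.\<close>
    obtain k where k: "axis k 1 \<notin> X"
    proof (rule ccontr)
      assume "\<not> thesis"
      then have "vec.span (range (\<lambda>l. axis l 1)) \<subseteq> X"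
        using that X(2) by (intro vec.span_minimal) auto
      then show False
        using contra span_axes by auto
    qed
    define u where "u j = (if j = k then 1 else 0 :: 'k)" for j
    have axis: "axis k 1 = (\<chi> j. emb (u j))"
      unfolding u_def by (rule axis_eq_emb_vec)
    define z where "z = x' $ l *s axis k 1"
    have "rk emb (x' + z) \<le> i"
      using rk_add_scale_emb_vec_le[of x' l u] x'(4) by (simp add: z_def axis)
    \<comment> \<open>Two terms give rank at most 2, which is at most \<open>i\<close>. Indexing by
      \<open>bool\<close> allows the two coefficients to be equal.\<close>
    moreover have "rk emb (b *s c b - z) \<le> i"
      using rk_sum_scale_emb_vec_le[of "UNIV :: bool set"
          "\<lambda>t. if t then b else - (x' $ l)" "\<lambda>t. if t then f b else u"] assms(1)
      by (simp add: UNIV_bool z_def axis c_def)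
    moreover have "z \<notin> X"
      unfolding z_def using k l by (rule subspace_scale_notin[OF X(2)])
    ultimately show False
      using not_modular_element_if_perturbation[OF x'(1,3) _ x'(5)] assms(2) by blast
  next
    case False
    then obtain k where k: "k \<in> B" "c k \<notin> X" by blast
    obtain l where l: "x $ l \<noteq> 0"
      using nonzero_entry xy by blast
    define z where "z = x $ l *s c k"
    have "rk emb (x + z) \<le> i"
      using rk_add_scale_emb_vec_le[of x l "f k"] xy(3) by (simp add: z_def c_def)
    moreover have "rk emb (y - z) \<le> i"
    proof -
      \<comment> \<open>Subtracting \<open>z\<close> only changes the coefficient of
        \<open>c k\<close> from \<open>k\<close> to \<open>k - x $ l\<close>, so the number of terms
        stays \<open>card B\<close>, the rank of \<open>y\<close>.\<close>
      have "y - z = (\<Sum>b\<in>B. b *s c b) - (\<Sum>b\<in>B. if b = k then x $ l *s c k else 0)"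
        using B(1) k(1) by (simp add: y z_def c_def)
      also have "\<dots> = (\<Sum>b\<in>B. (if b = k then k - x $ l else b) *s c b)"
        by (subst sum_subtractf[symmetric], intro sum.cong)
          (auto simp: vec.scale_left_diff_distrib)
      finally have "y - z = (\<Sum>b\<in>B. (if b = k then k - x $ l else b) *s c b)" .
      moreover have "rk emb (\<Sum>b\<in>B. (if b = k then k - x $ l else b) *s c b) \<le> card B"
        unfolding c_def using B(1) by (rule rk_sum_scale_emb_vec_le)
      ultimately show ?thesis
        using B(2) xy(4) by simp
    qed
    moreover have "z \<notin> X"
      unfolding z_def using k(2) l by (rule subspace_scale_notin[OF X(2)])
    ultimately show False
      using not_modular_element_if_perturbation[OF xy(1,2) _ xy(5)] assms(2) by blast
  qed
qed

end

theorem theorem3p15: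
  fixes emb :: "'k::{field,finite} \<Rightarrow> 'a::{field,finite}"
    and q n m i :: nat
  assumes "primepow q" and "CARD('k) = q"
    and "field_extension emb" and "ext_degree emb = m"
    and "CARD('n::finite) = n"
    and "n \<ge> 2" and "m \<ge> 2" and "i \<in> {2..n}"
  shows "{X :: ('a ^ 'n) set. modular_element emb i X}
       = {X. vec.subspace X \<and> X \<subseteq> T emb i} \<union> {UNIV}"
proof -
  interpret field_extension emb
    by (rule assms(3))
  have i: "2 \<le> i" "1 \<le> i"
    using assms(8) by auto
  have "modular_element emb i X \<longleftrightarrow> vec.subspace X \<and> X \<subseteq> T emb i \<or> X = UNIV"
    for X :: "('a ^ 'n) set"
  proof
    assume mod: "modular_element emb i X"
    then have "vec.subspace X"
      unfolding modular_element_def by (elim conjE rank_lattice_subspace)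
    then show "vec.subspace X \<and> X \<subseteq> T emb i \<or> X = UNIV"
      using modular_element_cases[OF i(1) mod] by simp
  next
    assume "vec.subspace X \<and> X \<subseteq> T emb i \<or> X = UNIV"
    then show "modular_element emb i X"
      by (elim disjE conjE) (simp_all add: modular_element_subset_T modular_element_UNIV[OF i(2)])
  qed
  then show ?thesis
    by auto
qed

end
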